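(* Let $(R,f,g)$ be a commutative Krasner $(m,n)$-hyperring with scalar identity $1$ and let $S$ be an $n$-ary multiplicative subset of $R$ with $1\in S$. If $I$ is an $n$-ary $S$-prime hyperideal of $R$ with $I\cap S=\varnothing$, then $S^{-1}I$ is an $n$-ary prime hyperideal of $S^{-1}R$.
   Context: Notation: $x_i^j$ denotes the sequence $x_i,\dots,x_j$ (empty if $j<i$); $x^{(k)}$ denotes $x$ repeated $k$ times; operations are extended to subsets elementwise (taking unions); $m,n\ge 2$ are integers. An $m$-ary hyperoperation on $R$ is a map $f$ from $R^m$ to the nonempty subsets of $R$. $(R,f)$ is a (commutative) canonical $m$-ary hypergroup if $f$ is invariant under permuting its arguments; $f$ is associative, i.e. $f(x_1^{i-1},f(x_i^{m+i-1}),x_{m+i}^{2m-1})$ does not depend on $i$; for all $a_1^{i-1},a_{i+1}^m,b\in R$ there is $x\in R$ with $b\in f(a_1^{i-1},x,a_{i+1}^m)$; there is a unique $0\in R$ with $f(x,0^{(m-1)})=\{x\}$ for all $x$; each $x$ has a unique $-x$ with $0\in f(x,-x,0^{(m-2)})$; and $x\in f(x_1^m)$ implies $x_i\in f(x,-x_1,\dots,-x_{i-1},-x_{i+1},\dots,-x_m)$ for all $i$. A commutative Krasner $(m,n)$-hyperring $(R,f,g)$ is such an $(R,f)$ together with an associative, permutation-invariant $n$-ary operation $g:R^n\to R$ that is distributive over $f$ in each argument, i.e. $g(a_1^{i-1},f(x_1^m),a_{i+1}^n)=f(g(a_1^{i-1},x_1,a_{i+1}^n),\dots,g(a_1^{i-1},x_m,a_{i+1}^n))$,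 and satisfies $g(0,x_2^n)=0$. A scalar identity is an element $1$ with $g(x,1^{(n-1)})=x$ for all $x$. A hyperideal of $R$ is a nonempty $I\subseteq R$ such that $(I,f)$ is an $m$-ary subhypergroup of $(R,f)$ (i.e. $f(x_1^m)\subseteq I$ for $x_1^m\in I$, and $b\in f(b_1^{i-1},x,b_{i+1}^m)$ has a solution $x\in I$ whenever all $b$'s lie in $I$) and $g(x_1^{i-1},I,x_{i+1}^n)\subseteq I$ for all $x_j\in R$ and all $i$. An $n$-ary prime hyperideal is a hyperideal $P\ne R$ such that for hyperideals $U_1,\dots,U_n$ of $R$, $g(U_1^n)\subseteq P$ implies $U_i\subseteq P$ for some $i$; equivalently, for all $x_1^n\in R$, $g(x_1^n)\in P$ implies $x_i\in P$ for some $i$. An $n$-ary multiplicative subset is a nonempty $S\subseteq R$ with $g(s_1^n)\in S$ for all $s_1^n\in S$. A hyperideal $I$ with $I\cap S=\varnothing$ is an $n$-ary $S$-prime hyperideal if there exists $s\in S$ such that for all $x_1^n\in R$ with $g(x_1^n)\in I$ one has $g(s,x_i,1^{(n-2)})\in I$ for some $1\le i\le n$. Hyperring of fractions (for $1\in S$): write $xy=g(x,y,1^{(n-2)})$, a commutative associative product with $g(x_1^n)=x_1x_2\cdots x_n$, under which $S$ is closed. $S^{-1}R$ is the set of classes $\frac{r}{s}$ of pairs $(r,s)\in R\times S$ under $(r,s)\sim(r',s')$ iff $trs'=tr's$ for some $t\in S$. It is a Krasner $(m,n)$-hyperring with $G(\frac{r_1}{s_1},\dots,\frac{r_n}{s_n})=\frac{g(r_1^n)}{g(s_1^n)}$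 and $F(\frac{r_1}{s_1},\dots,\frac{r_m}{s_m})=\{\frac{r}{s_1\cdots s_m}\mid r\in f(r_1\prod_{j\ne1}s_j,\dots,r_m\prod_{j\ne m}s_j)\}$, with scalar identity $\frac11$. For a hyperideal $I$, $S^{-1}I=\{\frac{a}{s}\mid a\in I,\ s\in S\}$. *)

theory Defs
  imports "HOL-Algebra.Congruence" "HOL-Library.Multiset"
begin

text \<open>
  A sequence \<open>x\<^sub>1, \<dots>, x\<^sub>k\<close> is a list of length \<open>k\<close>; a sequence with a distinguished entry is
  written \<open>as @ x # bs\<close>. An operation of arity \<open>k\<close> is a function on lists whose values only
  matter on lists of length \<open>k\<close> over the carrier.
\<close>

record 'a hyperstructure = "'a partial_object" +
  hadd :: "'a list \<Rightarrow> 'a set"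
  gmul :: "'a list \<Rightarrow> 'a"

definition seqs :: "nat \<Rightarrow> 'a set \<Rightarrow> 'a list set" where
  "seqs k A = {xs. length xs = k \<and> set xs \<subseteq> A}"

definition is_zero :: "nat \<Rightarrow> ('a, 'c) hyperstructure_scheme \<Rightarrow> 'a \<Rightarrow> bool" where
  "is_zero m R z \<longleftrightarrow> z \<in> carrier R \<and> (\<forall>x\<in>carrier R. hadd R (x # replicate (m - 1) z) = {x})"

definition hzero :: "nat \<Rightarrow> ('a, 'c) hyperstructure_scheme \<Rightarrow> 'a" where
  "hzero m R = (THE z. is_zero m R z)"

definition is_neg :: "nat \<Rightarrow> ('a, 'c) hyperstructure_scheme \<Rightarrow> 'a \<Rightarrow> 'a \<Rightarrow> bool" where
  "is_neg m R x y \<longleftrightarrow>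
     y \<in> carrier R \<and> hzero m R \<in> hadd R (x # y # replicate (m - 2) (hzero m R))"

definition hneg :: "nat \<Rightarrow> ('a, 'c) hyperstructure_scheme \<Rightarrow> 'a \<Rightarrow> 'a" where
  "hneg m R x = (THE y. is_neg m R x y)"

locale canonical_hypergroup =
  fixes m :: nat and R :: "('a, 'c) hyperstructure_scheme"
  assumes arity_m: "m \<ge> 2"
    and hadd_closed: "xs \<in> seqs m (carrier R) \<Longrightarrow> hadd R xs \<subseteq> carrier R"
    and hadd_nonempty: "xs \<in> seqs m (carrier R) \<Longrightarrow> hadd R xs \<noteq> {}"
    and hadd_perm:
      "\<lbrakk>xs \<in> seqs m (carrier R); ys \<in> seqs m (carrier R); mset xs = mset ys\<rbrakk>
        \<Longrightarrow> hadd R xs = hadd R ys"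
    and hadd_assoc:
      "\<lbrakk>xs \<in> seqs (2 * m - 1) (carrier R); i < m; j < m\<rbrakk>
        \<Longrightarrow> (\<Union>y\<in>hadd R (take m (drop i xs)). hadd R (take i xs @ y # drop (i + m) xs))
          = (\<Union>y\<in>hadd R (take m (drop j xs)). hadd R (take j xs @ y # drop (j + m) xs))"
    and hadd_solvable:
      "\<lbrakk>as @ bs \<in> seqs (m - 1) (carrier R); b \<in> carrier R\<rbrakk>
        \<Longrightarrow> \<exists>x\<in>carrier R. b \<in> hadd R (as @ x # bs)"
    and zero_ex1: "\<exists>!z. is_zero m R z"
    and neg_ex1: "x \<in> carrier R \<Longrightarrow> \<exists>!y. is_neg m R x y"
    and hadd_reversible:
      "\<lbrakk>as @ y # bs \<in> seqs m (carrier R); x \<in> hadd R (as @ y # bs)\<rbrakk>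
        \<Longrightarrow> y \<in> hadd R (x # map (hneg m R) (as @ bs))"

locale krasner_hyperring = canonical_hypergroup m R
  for m n :: nat and R :: "('a, 'c) hyperstructure_scheme" +
  assumes arity_n: "n \<ge> 2"
    and gmul_closed: "xs \<in> seqs n (carrier R) \<Longrightarrow> gmul R xs \<in> carrier R"
    and gmul_perm:
      "\<lbrakk>xs \<in> seqs n (carrier R); ys \<in> seqs n (carrier R); mset xs = mset ys\<rbrakk>
        \<Longrightarrow> gmul R xs = gmul R ys"
    and gmul_assoc:
      "\<lbrakk>xs \<in> seqs (2 * n - 1) (carrier R); i < n; j < n\<rbrakk>
        \<Longrightarrow> gmul R (take i xs @ gmul R (take n (drop i xs)) # drop (i + n) xs)
          = gmul R (take j xs @ gmul R (take n (drop j xs)) # drop (j + n) xs)"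
    and distrib:
      "\<lbrakk>as @ bs \<in> seqs (n - 1) (carrier R); xs \<in> seqs m (carrier R)\<rbrakk>
        \<Longrightarrow> (\<lambda>y. gmul R (as @ y # bs)) ` hadd R xs
          = hadd R (map (\<lambda>x. gmul R (as @ x # bs)) xs)"
    and gmul_zero:
      "xs \<in> seqs (n - 1) (carrier R) \<Longrightarrow> gmul R (hzero m R # xs) = hzero m R"

definition scalar_identity :: "nat \<Rightarrow> ('a, 'c) hyperstructure_scheme \<Rightarrow> 'a \<Rightarrow> bool" where
  "scalar_identity n R e \<longleftrightarrow>
     e \<in> carrier R \<and> (\<forall>x\<in>carrier R. gmul R (x # replicate (n - 1) e) = x)"

definition subhypergroup :: "nat \<Rightarrow> ('a, 'c) hyperstructure_scheme \<Rightarrow> 'a set \<Rightarrow> bool" where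
  "subhypergroup m R I \<longleftrightarrow>
     (\<forall>xs\<in>seqs m I. hadd R xs \<subseteq> I) \<and>
     (\<forall>as bs b. as @ bs \<in> seqs (m - 1) I \<and> b \<in> I \<longrightarrow> (\<exists>x\<in>I. b \<in> hadd R (as @ x # bs)))"

definition hyperideal :: "nat \<Rightarrow> nat \<Rightarrow> ('a, 'c) hyperstructure_scheme \<Rightarrow> 'a set \<Rightarrow> bool" where
  "hyperideal m n R I \<longleftrightarrow>
     I \<noteq> {} \<and> I \<subseteq> carrier R \<and> subhypergroup m R I \<and>
     (\<forall>as bs. as @ bs \<in> seqs (n - 1) (carrier R) \<longrightarrow> (\<forall>x\<in>I. gmul R (as @ x # bs) \<in> I))"

definition prime_hyperideal ::
    "nat \<Rightarrow> nat \<Rightarrow> ('a, 'c) hyperstructure_scheme \<Rightarrow> 'a set \<Rightarrow> bool" where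
  "prime_hyperideal m n R P \<longleftrightarrow>
     hyperideal m n R P \<and> P \<noteq> carrier R \<and>
     (\<forall>Us. length Us = n \<and> (\<forall>U\<in>set Us. hyperideal m n R U) \<and> gmul R ` listset Us \<subseteq> P
        \<longrightarrow> (\<exists>U\<in>set Us. U \<subseteq> P))"

definition multiplicative_subset ::
    "nat \<Rightarrow> ('a, 'c) hyperstructure_scheme \<Rightarrow> 'a set \<Rightarrow> bool" where
  "multiplicative_subset n R S \<longleftrightarrow>
     S \<noteq> {} \<and> S \<subseteq> carrier R \<and> (\<forall>xs\<in>seqs n S. gmul R xs \<in> S)"

text \<open>
  For \<open>n > 2\<close> a scalar identity need not be unique (for instance \<open>1\<close> and \<open>-1\<close> for the ternary
  product of integers), so the chosen one, \<open>e\<close>, is a parameter below.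
\<close>

definition S_prime_hyperideal ::
    "nat \<Rightarrow> nat \<Rightarrow> ('a, 'c) hyperstructure_scheme \<Rightarrow> 'a \<Rightarrow> 'a set \<Rightarrow> 'a set \<Rightarrow> bool" where
  "S_prime_hyperideal m n R e S I \<longleftrightarrow>
     hyperideal m n R I \<and> I \<inter> S = {} \<and>
     (\<exists>s\<in>S. \<forall>xs\<in>seqs n (carrier R). gmul R xs \<in> I
        \<longrightarrow> (\<exists>x\<in>set xs. gmul R (s # x # replicate (n - 2) e) \<in> I))"

definition bmul :: "nat \<Rightarrow> ('a, 'c) hyperstructure_scheme \<Rightarrow> 'a \<Rightarrow> 'a \<Rightarrow> 'a \<Rightarrow> 'a" where
  "bmul n R e x y = gmul R (x # y # replicate (n - 2) e)"

definition bprod :: "nat \<Rightarrow> ('a, 'c) hyperstructure_scheme \<Rightarrow> 'a \<Rightarrow> 'a list \<Rightarrow> 'a" where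
  "bprod n R e xs = foldr (bmul n R e) xs e"

definition frac_rel ::
    "nat \<Rightarrow> ('a, 'c) hyperstructure_scheme \<Rightarrow> 'a \<Rightarrow> 'a set \<Rightarrow> (('a \<times> 'a) \<times> ('a \<times> 'a)) set" where
  "frac_rel n R e S =
     {((r, s), (r', s')). r \<in> carrier R \<and> s \<in> S \<and> r' \<in> carrier R \<and> s' \<in> S \<and>
        (\<exists>t\<in>S. bprod n R e [t, r, s'] = bprod n R e [t, r', s])}"

definition frac ::
    "nat \<Rightarrow> ('a, 'c) hyperstructure_scheme \<Rightarrow> 'a \<Rightarrow> 'a set \<Rightarrow> 'a \<Rightarrow> 'a \<Rightarrow> ('a \<times> 'a) set" where
  "frac n R e S r s = frac_rel n R e S `` {(r, s)}"

text \<open>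
  The operations on classes are given by letting the representatives \<open>ps = [(r\<^sub>1, s\<^sub>1), \<dots>]\<close> range
  over all choices from the argument classes. For the hyperoperation this is a union of
  sets that all coincide; for the multiplication it is a singleton, whence the use of
  \<^const>\<open>the_elem\<close>.
\<close>

definition frac_hyperring ::
    "nat \<Rightarrow> ('a, 'c) hyperstructure_scheme \<Rightarrow> 'a \<Rightarrow> 'a set \<Rightarrow> ('a \<times> 'a) set hyperstructure" where
  "frac_hyperring n R e S =
     \<lparr>carrier = (carrier R \<times> S) // frac_rel n R e S,
      hadd = (\<lambda>Xs. {frac n R e S r (bprod n R e (map snd ps)) | r ps.
        ps \<in> listset Xs \<and>
        r \<in> hadd R (map (\<lambda>i. bmul n R e (fst (ps ! i))
                              (bprod n R e (map snd (take i ps @ drop (Suc i) ps))))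
                      [0..<length ps])}),
      gmul = (\<lambda>Xs. the_elem
        ((\<lambda>ps. frac n R e S (gmul R (map fst ps)) (gmul R (map snd ps))) ` listset Xs))\<rparr>"

definition frac_ideal ::
    "nat \<Rightarrow> ('a, 'c) hyperstructure_scheme \<Rightarrow> 'a \<Rightarrow> 'a set \<Rightarrow> 'a set \<Rightarrow> ('a \<times> 'a) set set" where
  "frac_ideal n R e S I = {frac n R e S a s | a s. a \<in> I \<and> s \<in> S}"

end

theory Submission
  imports Defs
begin

text \<open>
  The membership \<open>r/s \<in> S\<^sup>-\<^sup>1I\<close> holds iff \<open>tr \<in> I\<close> for some \<open>t \<in> S\<close>, whichever representative is
  chosen. Hence closure, absorption and primality of \<open>S\<^sup>-\<^sup>1I\<close> reduce to the same properties of
  \<open>I\<close> after multiplying by a suitable element of \<open>S\<close>, which can be moved into any one argument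
  of \<open>g\<close>; solvability is reduced to \<open>I\<close> by passing to a common denominator.
\<close>

text \<open>Used to recognise a pointwise choice \<open>map c Us\<close> as an element of the
  product of the hyperideals in \<open>Us\<close>.\<close>

lemma in_listset_iff: "xs \<in> listset As \<longleftrightarrow> list_all2 (\<in>) xs As"
  by (induction As arbitrary: xs) (auto simp: set_Cons_def list_all2_Cons2)

section \<open>The commutative monoid obtained by padding \<open>g\<close> with the identity
  \<open>e\<close>\<close>

locale krasner_fractions = krasner_hyperring m n R
  for m n :: nat and R :: "('a, 'c) hyperstructure_scheme" +
  fixes e :: 'a and S :: "'a set"
  assumes scalar_identity: "scalar_identity n R e"
    and multiplicative: "multiplicative_subset n R S"
    and e_in_S: "e \<in> S"
begin

abbreviation mult (infixl "\<cdot>" 70) where "x \<cdot> y \<equiv> bmul n R e x y"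
abbreviation "bp \<equiv> bprod n R e"
abbreviation "fr \<equiv> frac n R e S"
abbreviation "Q \<equiv> frac_hyperring n R e S"

lemma S_carrier: "s \<in> S \<Longrightarrow> s \<in> carrier R"
  using multiplicative by (auto simp: multiplicative_subset_def)

lemma e_carrier [simp]: "e \<in> carrier R"
  using e_in_S S_carrier by blast

lemma gmul_identity: "x \<in> carrier R \<Longrightarrow> gmul R (x # replicate (n - 1) e) = x"
  using scalar_identity by (auto simp: scalar_identity_def)

lemma padded_seqs: "x \<in> carrier R \<Longrightarrow> x # replicate (n - 2) e \<in> seqs (n - 1) (carrier R)"
  using arity_n by (auto simp: seqs_def)

lemma mult_closed [simp]: "\<lbrakk>x \<in> carrier R; y \<in> carrier R\<rbrakk> \<Longrightarrow> x \<cdot> y \<in> carrier R"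
  unfolding bmul_def using arity_n by (intro gmul_closed) (auto simp: seqs_def)

lemma mult_S [simp]: "\<lbrakk>x \<in> S; y \<in> S\<rbrakk> \<Longrightarrow> x \<cdot> y \<in> S"
proof -
  assume "x \<in> S" "y \<in> S"
  then have "x # y # replicate (n - 2) e \<in> seqs n S"
    using arity_n e_in_S by (auto simp: seqs_def)
  then show ?thesis
    using multiplicative by (simp add: bmul_def multiplicative_subset_def)
qed

lemma mult_commute: "\<lbrakk>x \<in> carrier R; y \<in> carrier R\<rbrakk> \<Longrightarrow> x \<cdot> y = y \<cdot> x"
  unfolding bmul_def using arity_n by (intro gmul_perm) (auto simp: seqs_def)

lemma mult_e_right [simp]: "x \<in> carrier R \<Longrightarrow> x \<cdot> e = x"
proof -
  have "e # replicate (n - 2) e = replicate (n - 1) e"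
    using arity_n by (simp flip: replicate_Suc add: Suc_diff_Suc numeral_2_eq_2)
  then show "x \<in> carrier R \<Longrightarrow> x \<cdot> e = x"
    using gmul_identity[of x] by (simp add: bmul_def)
qed

lemma mult_e_left [simp]: "x \<in> carrier R \<Longrightarrow> e \<cdot> x = x"
  using mult_commute[of e x] by simp

lemma mult_assoc:
  assumes "x \<in> carrier R" "y \<in> carrier R" "z \<in> carrier R"
  shows "x \<cdot> y \<cdot> z = x \<cdot> (y \<cdot> z)"
proof -
  let ?E = "replicate (n - 2) e"
  \<comment> \<open>This list has length \<open>2 * n - 1\<close>. Bracketing at position 0 gives
    \<open>x \<cdot> y \<cdot> z\<close>. Bracketing at position 1 gives \<open>x\<close> times
    \<open>gmul R (y # ?E @ [z])\<close>, which is \<open>y \<cdot> z\<close> up to a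
    permutation.\<close>
  let ?xs = "x # y # ?E @ z # ?E"
  have "gmul R (take 0 ?xs @ gmul R (take n (drop 0 ?xs)) # drop (0 + n) ?xs)
      = gmul R (take 1 ?xs @ gmul R (take n (drop 1 ?xs)) # drop (1 + n) ?xs)"
    using arity_n assms by (intro gmul_assoc) (auto simp: seqs_def)
  moreover obtain k where "n = Suc (Suc k)"
    using arity_n by (metis add_2_eq_Suc le_Suc_ex)
  moreover have "gmul R (y # ?E @ [z]) = y \<cdot> z"
    unfolding bmul_def using arity_n assms by (intro gmul_perm) (auto simp: seqs_def)
  ultimately show ?thesis
    by (simp add: bmul_def)
qed

lemma mult_left_commute:
  "\<lbrakk>x \<in> carrier R; y \<in> carrier R; z \<in> carrier R\<rbrakk> \<Longrightarrow> x \<cdot> (y \<cdot> z) = y \<cdot> (x \<cdot> z)"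
  by (metis mult_assoc mult_commute)

lemmas mult_ac = mult_assoc mult_commute mult_left_commute

lemma bprod_Nil [simp]: "bp [] = e"
  and bprod_Cons [simp]: "bp (x # xs) = x \<cdot> bp xs"
  by (simp_all add: bprod_def)

lemma bprod_closed [simp]: "set xs \<subseteq> carrier R \<Longrightarrow> bp xs \<in> carrier R"
  by (induction xs) auto

lemma bprod_S: "set xs \<subseteq> S \<Longrightarrow> bp xs \<in> S"
  by (induction xs) (auto simp: e_in_S)

text \<open>Padding with \<open>e\<close> makes induction on the list possible although
  \<open>g\<close> has fixed arity: each step splits off one factor by associativity, and the
  full-length case identifies \<open>g\<close> with the iterated binary product.\<close>

lemma gmul_padded_eq_bprod:
  "\<lbrakk>length xs \<le> n; set xs \<subseteq> carrier R\<rbrakk>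
    \<Longrightarrow> gmul R (xs @ replicate (n - length xs) e) = bp xs"
proof (induction xs)
  case Nil
  have "e # replicate (n - 1) e = replicate n e"
    using arity_n by (simp flip: replicate_Suc)
  then show ?case using gmul_identity[of e] by simp
next
  case (Cons x xs)
  let ?k = "length xs"
  \<comment> \<open>Again of length \<open>2 * n - 1\<close>. The inner bracket at position 0 leaves
    \<open>n - 1\<close> copies of \<open>e\<close> outside, which the identity law removes. The one
    at position 1 leaves \<open>x\<close> in front and \<open>n - 2\<close> copies behind, which is
    the binary product with \<open>x\<close>.\<close>
  let ?ys = "x # xs @ replicate (n - ?k) e @ replicate (n - 2) e"
  have "gmul R (take 0 ?ys @ gmul R (take n (drop 0 ?ys)) # drop (0 + n) ?ys)
      = gmul R (take 1 ?ys @ gmul R (take n (drop 1 ?ys)) # drop (1 + n) ?ys)"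
    using arity_n Cons.prems by (intro gmul_assoc) (auto simp: seqs_def)
  moreover have "?ys = (x # xs @ replicate (n - Suc ?k) e) @ replicate (n - 1) e"
  proof -
    have "n - ?k + (n - 2) = n - Suc ?k + (n - 1)" using arity_n Cons.prems by simp
    then show ?thesis by (simp flip: replicate_add)
  qed
  then have "take n ?ys = x # xs @ replicate (n - Suc ?k) e" "drop n ?ys = replicate (n - 1) e"
    using Cons.prems by (simp_all del: append_assoc append_Cons)
  moreover have "take n (drop 1 ?ys) = xs @ replicate (n - ?k) e"
      "drop (1 + n) ?ys = replicate (n - 2) e" "take 1 ?ys = [x]"
    using Cons.prems by simp_all
  moreover have "gmul R (x # xs @ replicate (n - Suc ?k) e) \<in> carrier R"
    using Cons.prems by (intro gmul_closed) (auto simp: seqs_def)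
  ultimately have "gmul R (x # xs @ replicate (n - Suc ?k) e)
      = x \<cdot> gmul R (xs @ replicate (n - ?k) e)"
    by (simp only: take0 drop0 add_0 append_Nil append_Cons bmul_def gmul_identity)
  with Cons show ?case by simp
qed

lemma gmul_eq_bprod: "xs \<in> seqs n (carrier R) \<Longrightarrow> gmul R xs = bp xs"
  using gmul_padded_eq_bprod[of xs] by (simp add: seqs_def)

lemma mult_hadd:
  assumes "xs \<in> seqs m (carrier R)" "c \<in> carrier R"
  shows "(\<cdot>) c ` hadd R xs = hadd R (map ((\<cdot>) c) xs)"
  using distrib[of "[c]" "replicate (n - 2) e" xs] assms padded_seqs[of c]
  by (simp add: bmul_def[abs_def])

section \<open>Fractions as equivalence classes\<close>

lemma equiv_frac_rel: "equiv (carrier R \<times> S) (frac_rel n R e S)"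
proof (rule equivI)
  show "frac_rel n R e S \<subseteq> (carrier R \<times> S) \<times> (carrier R \<times> S)"
    by (auto simp: frac_rel_def)
  show "refl_on (carrier R \<times> S) (frac_rel n R e S)"
    using e_in_S by (auto simp: refl_on_def frac_rel_def)
  show "sym (frac_rel n R e S)"
    by (auto simp: sym_def frac_rel_def) metis
  show "trans (frac_rel n R e S)"
  \<comment> \<open>Simplification also drops the final factor \<open>e\<close> of each
    \<open>bprod\<close>, which leaves products of three factors.\<close>
  proof (rule transI, clarsimp simp: frac_rel_def S_carrier)
    fix a b c d p q t u
    assume car: "a \<in> carrier R" "c \<in> carrier R" "p \<in> carrier R"
      and S: "b \<in> S" "d \<in> S" "q \<in> S" "t \<in> S" "u \<in> S"
      and eq: "t \<cdot> (a \<cdot> d) = t \<cdot> (c \<cdot> b)" "u \<cdot> (c \<cdot> q) = u \<cdot> (p \<cdot> d)"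
    note car' = car S[THEN S_carrier]
    \<comment> \<open>Besides the two given multipliers, the new one contains the middle denominator
      \<open>d\<close>, so that \<open>a \<cdot> d\<close> can be replaced through the first
      equation and \<open>p \<cdot> d\<close> recovered from the second.\<close>
    have "(t \<cdot> u \<cdot> d) \<cdot> (a \<cdot> q) = (u \<cdot> q) \<cdot> (t \<cdot> (a \<cdot> d))"
      using car' by (simp add: mult_ac)
    also have "\<dots> = (t \<cdot> b) \<cdot> (u \<cdot> (c \<cdot> q))"
      unfolding eq(1) using car' by (simp add: mult_ac)
    also have "\<dots> = (t \<cdot> u \<cdot> d) \<cdot> (p \<cdot> b)"
      unfolding eq(2) using car' by (simp add: mult_ac)
    finally show "\<exists>t\<in>S. t \<cdot> (a \<cdot> q) = t \<cdot> (p \<cdot> b)"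
      using S by (intro bexI[of _ "t \<cdot> u \<cdot> d"]) auto
  qed
qed

lemma frac_rel_iff:
  assumes "r \<in> carrier R" "s \<in> S" "r' \<in> carrier R" "s' \<in> S"
  shows "((r, s), (r', s')) \<in> frac_rel n R e S \<longleftrightarrow> (\<exists>t\<in>S. t \<cdot> (r \<cdot> s') = t \<cdot> (r' \<cdot> s))"
  using assms by (auto simp: frac_rel_def S_carrier)

lemma frac_eq_iff:
  assumes "r \<in> carrier R" "s \<in> S" "r' \<in> carrier R" "s' \<in> S"
  shows "fr r s = fr r' s' \<longleftrightarrow> (\<exists>t\<in>S. t \<cdot> (r \<cdot> s') = t \<cdot> (r' \<cdot> s))"
  using assms eq_equiv_class_iff[OF equiv_frac_rel] frac_rel_iff by (simp add: frac_def)

lemma in_frac_iff: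
  assumes "r \<in> carrier R" "s \<in> S"
  shows "p \<in> fr r s \<longleftrightarrow> fst p \<in> carrier R \<and> snd p \<in> S \<and> fr (fst p) (snd p) = fr r s"
proof (cases p)
  case (Pair r' s')
  then show ?thesis
    using assms frac_rel_iff[of r s r' s'] frac_eq_iff[of r s r' s']
    by (auto simp: frac_def frac_rel_def)
qed

lemma frac_cancel:
  assumes "t \<in> S" "r \<in> carrier R" "s \<in> S"
  shows "fr (t \<cdot> r) (t \<cdot> s) = fr r s"
  using assms e_in_S
  by (subst frac_eq_iff) (auto simp: S_carrier mult_ac intro!: bexI[of _ e])

lemma carrier_frac: "carrier Q = {fr r s | r s. r \<in> carrier R \<and> s \<in> S}"
  by (auto simp: frac_hyperring_def frac_def quotient_def)

section \<open>Lists of fractions and the multiplication of \<open>Q\<close>\<close>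

lemma carrier_frac_list:
  assumes "set Xs \<subseteq> carrier Q"
  obtains ps where "Xs = map (\<lambda>p. fr (fst p) (snd p)) ps" "set ps \<subseteq> carrier R \<times> S"
proof -
  have "\<exists>ps. Xs = map (\<lambda>p. fr (fst p) (snd p)) ps \<and> set ps \<subseteq> carrier R \<times> S"
    using assms
  proof (induction Xs)
    case (Cons X Xs)
    then obtain ps r s where "Xs = map (\<lambda>p. fr (fst p) (snd p)) ps" "set ps \<subseteq> carrier R \<times> S"
      "X = fr r s" "r \<in> carrier R" "s \<in> S"
      by (auto simp: carrier_frac)
    then show ?case by (intro exI[of _ "(r, s) # ps"]) auto
  qed auto
  with that show ?thesis by blast
qed

text \<open>Turns the choice of representatives in the operations of \<open>Q\<close> into an
  equation between lists of classes.\<close>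

lemma in_listset_frac_iff:
  assumes "set ps \<subseteq> carrier R \<times> S"
  shows "qs \<in> listset (map (\<lambda>p. fr (fst p) (snd p)) ps) \<longleftrightarrow>
    set qs \<subseteq> carrier R \<times> S \<and>
    map (\<lambda>p. fr (fst p) (snd p)) qs = map (\<lambda>p. fr (fst p) (snd p)) ps"
  using assms
proof (induction ps arbitrary: qs)
  case Nil
  then show ?case by auto
next
  case (Cons p ps)
  then show ?case
    by (cases qs) (auto simp: set_Cons_def in_frac_iff)
qed

text \<open>Well-definedness of products of fractions. The induction treats lists of every length;
  at each step the product of the witnesses for head and tail is a witness for the whole.\<close>

lemma frac_bprod_cong:
  assumes "set ps \<subseteq> carrier R \<times> S" "set qs \<subseteq> carrier R \<times> S"
    and "map (\<lambda>p. fr (fst p) (snd p)) qs = map (\<lambda>p. fr (fst p) (snd p)) ps"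
  shows "fr (bp (map fst qs)) (bp (map snd qs)) = fr (bp (map fst ps)) (bp (map snd ps))"
proof -
  have "length ps = length qs" using assms(3) by (metis length_map)
  then show ?thesis using assms
  proof (induction ps qs rule: list_induct2)
    case (Cons p ps q qs)
    obtain a b c d where pq: "p = (a, b)" "q = (c, d)" by fastforce
    let ?a = "bp (map fst ps)" and ?b = "bp (map snd ps)"
      and ?c = "bp (map fst qs)" and ?d = "bp (map snd qs)"
    have S: "b \<in> S" "d \<in> S" "?b \<in> S" "?d \<in> S"
      and car: "a \<in> carrier R" "c \<in> carrier R" "?a \<in> carrier R" "?c \<in> carrier R"
      using Cons.prems pq by (fastforce intro!: bprod_S bprod_closed)+
    obtain t where t: "t \<in> S" "t \<cdot> (c \<cdot> b) = t \<cdot> (a \<cdot> d)"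
      using Cons.prems pq S car by (auto simp: frac_eq_iff)
    have "fr ?c ?d = fr ?a ?b" using Cons by simp
    then obtain u where u: "u \<in> S" "u \<cdot> (?c \<cdot> ?b) = u \<cdot> (?a \<cdot> ?d)"
      using S car by (auto simp: frac_eq_iff)
    note car' = car S[THEN S_carrier] t(1)[THEN S_carrier] u(1)[THEN S_carrier]
    have "(t \<cdot> u) \<cdot> ((c \<cdot> ?c) \<cdot> (b \<cdot> ?b)) = (t \<cdot> (c \<cdot> b)) \<cdot> (u \<cdot> (?c \<cdot> ?b))"
      using car' by (simp add: mult_ac)
    also have "\<dots> = (t \<cdot> u) \<cdot> ((a \<cdot> ?a) \<cdot> (d \<cdot> ?d))"
      unfolding t u using car' by (simp add: mult_ac)
    finally have "fr (c \<cdot> ?c) (d \<cdot> ?d) = fr (a \<cdot> ?a) (b \<cdot> ?b)"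
      using t u car S by (subst frac_eq_iff) (auto intro!: bexI[of _ "t \<cdot> u"])
    then show ?case by (simp add: pq)
  qed auto
qed

lemma seqs_map_fst_snd:
  assumes "set ps \<subseteq> carrier R \<times> S" "length ps = k"
  shows "map fst ps \<in> seqs k (carrier R)" "map snd ps \<in> seqs k S" "map snd ps \<in> seqs k (carrier R)"
  using assms by (fastforce simp: seqs_def S_carrier)+

text \<open>All choices of representatives give the same class by \<open>frac_bprod_cong\<close>,
  and \<open>ps\<close> itself is one of them, so \<open>the_elem\<close> is applied to a genuine
  singleton.\<close>

lemma gmul_frac:
  assumes "set ps \<subseteq> carrier R \<times> S" "length ps = n"
  shows "gmul Q (map (\<lambda>p. fr (fst p) (snd p)) ps) = fr (bp (map fst ps)) (bp (map snd ps))"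
proof -
  let ?F = "\<lambda>p. fr (fst p) (snd p)"
  have "(\<lambda>ps. fr (gmul R (map fst ps)) (gmul R (map snd ps))) ` listset (map ?F ps)
      = {fr (bp (map fst ps)) (bp (map snd ps))}"
  proof (intro equalityI subsetI)
    fix X
    assume "X \<in> (\<lambda>ps. fr (gmul R (map fst ps)) (gmul R (map snd ps))) ` listset (map ?F ps)"
    then obtain qs where qs: "set qs \<subseteq> carrier R \<times> S" "map ?F qs = map ?F ps"
      "X = fr (gmul R (map fst qs)) (gmul R (map snd qs))"
      using in_listset_frac_iff[OF assms(1)] by auto
    have "length qs = n" using qs(2) assms(2) by (metis length_map)
    then show "X \<in> {fr (bp (map fst ps)) (bp (map snd ps))}"
      using qs assms(1) frac_bprod_cong[of ps qs]
      by (simp add: gmul_eq_bprod seqs_map_fst_snd)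
  next
    fix X
    assume "X \<in> {fr (bp (map fst ps)) (bp (map snd ps))}"
    moreover have "ps \<in> listset (map ?F ps)"
      using in_listset_frac_iff[OF assms(1)] assms by simp
    ultimately show
      "X \<in> (\<lambda>ps. fr (gmul R (map fst ps)) (gmul R (map snd ps))) ` listset (map ?F ps)"
      using assms by (intro image_eqI[of _ _ ps]) (auto simp: gmul_eq_bprod seqs_map_fst_snd)
  qed
  then show ?thesis by (simp add: frac_hyperring_def)
qed

end

section \<open>Fractions with numerator in a hyperideal\<close>

locale krasner_fractions_ideal = krasner_fractions +
  fixes I :: "'a set"
  assumes ideal: "hyperideal m n R I"
begin

abbreviation "SI \<equiv> frac_ideal n R e S I"

lemma I_carrier: "a \<in> I \<Longrightarrow> a \<in> carrier R"
  using ideal by (auto simp: hyperideal_def)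

lemma gmul_I: "\<lbrakk>as @ bs \<in> seqs (n - 1) (carrier R); x \<in> I\<rbrakk> \<Longrightarrow> gmul R (as @ x # bs) \<in> I"
  using ideal by (simp add: hyperideal_def)

lemma mult_I: "\<lbrakk>t \<in> carrier R; a \<in> I\<rbrakk> \<Longrightarrow> t \<cdot> a \<in> I"
  using gmul_I[of "[t]" "replicate (n - 2) e" a] padded_seqs[of t]
  by (simp add: bmul_def)

text \<open>If \<open>r/s = a/u\<close> with \<open>a \<in> I\<close>, a witness \<open>t\<close> of
  this equality gives \<open>t \<cdot> u \<cdot> r = t \<cdot> s \<cdot> a\<close>, which lies in
  \<open>I\<close> by absorption. Conversely, \<open>r/s\<close> equals
  \<open>(t \<cdot> r)/(t \<cdot> s)\<close>.\<close>

lemma frac_in_frac_ideal_iff: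
  assumes "r \<in> carrier R" "s \<in> S"
  shows "fr r s \<in> SI \<longleftrightarrow> (\<exists>t\<in>S. t \<cdot> r \<in> I)"
proof
  assume "fr r s \<in> SI"
  then obtain a u where a: "a \<in> I" "u \<in> S" "fr r s = fr a u"
    by (auto simp: frac_ideal_def)
  then obtain t where t: "t \<in> S" "t \<cdot> (r \<cdot> u) = t \<cdot> (a \<cdot> s)"
    using assms by (auto simp: frac_eq_iff I_carrier)
  have "t \<cdot> u \<cdot> r = t \<cdot> (r \<cdot> u)"
    using assms a t by (simp add: S_carrier mult_ac)
  also have "\<dots> = t \<cdot> s \<cdot> a"
    using assms a t by (simp add: S_carrier I_carrier mult_ac)
  also have "\<dots> \<in> I"
    using assms a t by (intro mult_I) (auto simp: S_carrier)
  finally show "\<exists>t\<in>S. t \<cdot> r \<in> I"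
    using a t by (intro bexI[of _ "t \<cdot> u"]) auto
next
  assume "\<exists>t\<in>S. t \<cdot> r \<in> I"
  then obtain t where "t \<in> S" "t \<cdot> r \<in> I" by blast
  with frac_cancel[of t r s] assms show "fr r s \<in> SI"
    unfolding frac_ideal_def by (metis (mono_tags, lifting) mem_Collect_eq mult_S)
qed

lemma frac_ideal_subset_carrier: "SI \<subseteq> carrier Q"
  unfolding frac_ideal_def carrier_frac using I_carrier by blast

text \<open>The multipliers of the single fractions are multiplied together; by absorption the extra
  factors do no harm. One common multiplier is what distributivity over a hypersum requires.\<close>

lemma uniform_multiplier:
  assumes "set ps \<subseteq> carrier R \<times> S" "\<forall>p\<in>set ps. fr (fst p) (snd p) \<in> SI"
  shows "\<exists>t\<in>S. \<forall>p\<in>set ps. t \<cdot> fst p \<in> I"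
  using assms
proof (induction ps)
  case Nil
  then show ?case using e_in_S by auto
next
  case (Cons p ps)
  then obtain t where t: "t \<in> S" "\<forall>p\<in>set ps. t \<cdot> fst p \<in> I" by auto
  have p: "fst p \<in> carrier R" "snd p \<in> S" using Cons.prems by auto
  with Cons.prems obtain u where u: "u \<in> S" "u \<cdot> fst p \<in> I"
    using frac_in_frac_ideal_iff by fastforce
  have "t \<cdot> u \<cdot> fst p \<in> I"
    using mult_I[of t "u \<cdot> fst p"] t u p by (simp add: S_carrier mult_assoc)
  moreover have "t \<cdot> u \<cdot> fst q \<in> I" if "q \<in> set ps" for q
  proof -
    have "fst q \<in> carrier R" using that Cons.prems by auto
    then have "t \<cdot> u \<cdot> fst q = u \<cdot> (t \<cdot> fst q)"
      using t u by (simp add: S_carrier mult_ac)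
    then show ?thesis using mult_I[of u "t \<cdot> fst q"] t u that by (simp add: S_carrier)
  qed
  ultimately show ?case using t u by (intro bexI[of _ "t \<cdot> u"]) auto
qed

text \<open>Cross-multiplication keeps the numerators in \<open>I\<close> by absorption. This allows
  a solvability problem in \<open>SI\<close> to be read as one in \<open>I\<close>.\<close>

lemma common_denominator:
  "set Xs \<subseteq> SI \<Longrightarrow> \<exists>d\<in>S. \<exists>ys. set ys \<subseteq> I \<and> Xs = map (\<lambda>a. fr a d) ys"
proof (induction Xs)
  case Nil
  then show ?case using e_in_S by auto
next
  case (Cons X Xs)
  then obtain d ys where d: "d \<in> S" "set ys \<subseteq> I" "Xs = map (\<lambda>a. fr a d) ys" by auto
  obtain a s where a: "a \<in> I" "s \<in> S" "X = fr a s"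
    using Cons.prems by (auto simp: frac_ideal_def)
  have "X = fr (d \<cdot> a) (s \<cdot> d)"
    using frac_cancel[of d a s] a d by (simp add: S_carrier I_carrier mult_commute[of s d])
  moreover have "Xs = map (\<lambda>a. fr a (s \<cdot> d)) (map ((\<cdot>) s) ys)"
    using d a by (auto simp: frac_cancel I_carrier subset_iff)
  moreover have "set (d \<cdot> a # map ((\<cdot>) s) ys) \<subseteq> I"
    using d a by (auto intro!: mult_I simp: S_carrier)
  ultimately show ?case
    using a d by (intro bexI[of _ "s \<cdot> d"] exI[of _ "d \<cdot> a # map ((\<cdot>) s) ys"]) auto
qed

section \<open>Hyperaddition on \<open>SI\<close>: closure and solvability\<close>

lemma hadd_I: "\<lbrakk>length xs = m; set xs \<subseteq> I\<rbrakk> \<Longrightarrow> hadd R xs \<subseteq> I"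
  using ideal by (auto simp: hyperideal_def subhypergroup_def seqs_def)

text \<open>The representatives entering a hypersum may have numerators outside \<open>I\<close>. A
  common multiplier \<open>t\<close> brings them into \<open>I\<close>, and by distributivity
  \<open>t \<cdot> r\<close> belongs to a hypersum of elements of \<open>I\<close>.\<close>

lemma hadd_frac_ideal:
  assumes "Xs \<in> seqs m SI"
  shows "hadd Q Xs \<subseteq> SI"
proof
  fix Y
  assume Y: "Y \<in> hadd Q Xs"
  let ?F = "\<lambda>p. fr (fst p) (snd p)"
  let ?ys = "\<lambda>qs. map (\<lambda>i. fst (qs ! i) \<cdot> bp (map snd (take i qs @ drop (Suc i) qs)))
                   [0..<length qs]"
  have "set Xs \<subseteq> carrier Q"
    using assms frac_ideal_subset_carrier by (auto simp: seqs_def)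
  then obtain ps where ps: "Xs = map ?F ps" "set ps \<subseteq> carrier R \<times> S"
    by (rule carrier_frac_list)
  obtain r qs where "qs \<in> listset Xs" and r: "r \<in> hadd R (?ys qs)"
      and Y: "Y = fr r (bp (map snd qs))"
    using Y by (auto simp: frac_hyperring_def)
  then have qs: "set qs \<subseteq> carrier R \<times> S" "map ?F qs = Xs"
    using in_listset_frac_iff[OF ps(2)] ps(1) by simp_all
  have len: "length qs = m"
    using qs(2) assms by (auto simp: seqs_def)
  have "set (map ?F qs) \<subseteq> SI"
    unfolding qs(2) using assms by (simp add: seqs_def)
  then have "\<forall>p\<in>set qs. ?F p \<in> SI"
    by auto
  then obtain t where t: "t \<in> S" "\<forall>p\<in>set qs. t \<cdot> fst p \<in> I"
    using uniform_multiplier[OF qs(1)] by blast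
  let ?c = "\<lambda>i. bp (map snd (take i qs @ drop (Suc i) qs))"
  have c: "?c i \<in> carrier R" for i
  proof (rule bprod_closed)
    have "set (take i qs @ drop (Suc i) qs) \<subseteq> set qs"
      by (auto dest: in_set_takeD in_set_dropD)
    with qs(1) show "set (map snd (take i qs @ drop (Suc i) qs)) \<subseteq> carrier R"
      by (fastforce simp: S_carrier)
  qed
  have fst: "fst (qs ! i) \<in> carrier R" if "i < m" for i
    using that qs(1) len nth_mem by fastforce
  have ys: "?ys qs \<in> seqs m (carrier R)"
    using len c fst by (auto simp: seqs_def)
  then have r_car: "r \<in> carrier R"
    using r hadd_closed by blast
  have "t \<cdot> (fst (qs ! i) \<cdot> ?c i) \<in> I" if "i < m" for i
  proof -
    have "t \<cdot> (fst (qs ! i) \<cdot> ?c i) = ?c i \<cdot> (t \<cdot> fst (qs ! i))"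
      using c[of i] fst[OF that] t by (simp add: S_carrier mult_ac)
    then show ?thesis using mult_I[OF c[of i]] t that len by simp
  qed
  then have "hadd R (map ((\<cdot>) t) (?ys qs)) \<subseteq> I"
    using len by (intro hadd_I) auto
  then have "t \<cdot> r \<in> I"
    using mult_hadd[OF ys, of t] r t by (auto simp: S_carrier)
  moreover have "bp (map snd qs) \<in> S"
    using qs(1) by (intro bprod_S) auto
  ultimately show "Y \<in> SI"
    using Y t r_car frac_in_frac_ideal_iff by blast
qed

text \<open>With representatives \<open>(a, d)\<close> every numerator receives the same factor
  \<open>?c\<close>, the power of \<open>d\<close> with exponent \<open>m - 1\<close>.
  Distributivity puts \<open>?c \<cdot> b\<close> into the hypersum of the numerators, and over the
  denominator \<open>d \<cdot> ?c\<close> it cancels to \<open>b/d\<close>.\<close>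

lemma frac_in_hadd:
  assumes "length ys = m" "set ys \<subseteq> carrier R" "d \<in> S" "b \<in> hadd R ys"
  shows "fr b d \<in> hadd Q (map (\<lambda>a. fr a d) ys)"
proof -
  let ?ps = "map (\<lambda>a. (a, d)) ys"
  let ?c = "bp (replicate (m - 1) d)"
  have c: "?c \<in> S" using assms by (intro bprod_S) auto
  have "?ps \<in> listset (map (\<lambda>p. fr (fst p) (snd p)) ?ps)"
    using assms by (subst in_listset_frac_iff) auto
  then have ps: "?ps \<in> listset (map (\<lambda>a. fr a d) ys)" by (simp add: comp_def)
  have "b \<in> carrier R"
    using assms hadd_closed[of ys] by (auto simp: seqs_def)
  have d: "map snd ?ps = replicate m d"
    using assms(1) by (auto simp: comp_def map_replicate_const)
  have "map (\<lambda>i. fst (?ps ! i) \<cdot> bp (map snd (take i ?ps @ drop (Suc i) ?ps))) [0..<length ?ps]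
      = map ((\<cdot>) ?c) ys"
  proof (rule nth_equalityI)
    fix i
    assume "i < length (map (\<lambda>i. fst (?ps ! i) \<cdot>
        bp (map snd (take i ?ps @ drop (Suc i) ?ps))) [0..<length ?ps])"
    then have i: "i < m" using assms(1) by simp
    \<comment> \<open>Deleting any one of the \<open>m\<close> equal denominators leaves
      \<open>m - 1\<close> copies of \<open>d\<close>, so the cofactor does not depend on
      \<open>i\<close>.\<close>
    have "map snd (take i ?ps @ drop (Suc i) ?ps)
        = take i (map snd ?ps) @ drop (Suc i) (map snd ?ps)"
      by (simp only: map_append take_map drop_map)
    also have "\<dots> = replicate (m - 1) d"
      unfolding d using i by (simp add: min_def flip: replicate_add)
    finally have "map snd (take i ?ps @ drop (Suc i) ?ps) = replicate (m - 1) d" .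
    moreover have "ys ! i \<in> carrier R" using i assms by auto
    ultimately show "map (\<lambda>i. fst (?ps ! i) \<cdot>
        bp (map snd (take i ?ps @ drop (Suc i) ?ps))) [0..<length ?ps] ! i = map ((\<cdot>) ?c) ys ! i"
      using i assms c by (simp add: mult_commute S_carrier del: map_append)
  qed simp
  moreover have "?c \<cdot> b \<in> hadd R (map ((\<cdot>) ?c) ys)"
    using mult_hadd[of ys ?c] assms c by (auto simp: seqs_def S_carrier)
  moreover have "fr b d = fr (?c \<cdot> b) (bp (map snd ?ps))"
  proof -
    have "bp (map snd ?ps) = d \<cdot> ?c"
      unfolding d using arity_m by (cases m) auto
    then show ?thesis
      using frac_cancel[of ?c b d] c assms(3) \<open>b \<in> carrier R\<close>
      by (simp add: mult_commute S_carrier)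
  qed
  ultimately show ?thesis
    using ps unfolding frac_hyperring_def
    by (simp del: map_map) (rule exI[of _ "?c \<cdot> b"], rule exI[of _ ?ps], simp del: map_map)
qed

lemma subhypergroup_frac_ideal: "subhypergroup m Q SI"
  unfolding subhypergroup_def
proof (intro conjI allI impI ballI)
  fix As Bs B
  assume "As @ Bs \<in> seqs (m - 1) SI \<and> B \<in> SI"
  then have len: "length (As @ Bs) = m - 1" and "set (B # As @ Bs) \<subseteq> SI"
    by (auto simp: seqs_def)
  \<comment> \<open>The target \<open>B\<close> is put in the list so that it shares the denominator
    \<open>d\<close> with the given summands.\<close>
  then obtain d ys where d: "d \<in> S" "set ys \<subseteq> I" "B # As @ Bs = map (\<lambda>a. fr a d) ys"
    using common_denominator[of "B # As @ Bs"] by metis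
  from d(3) obtain b as bs where ys: "ys = b # as @ bs" "B = fr b d"
      "As = map (\<lambda>a. fr a d) as" "Bs = map (\<lambda>a. fr a d) bs"
    by (auto simp: Cons_eq_map_conv append_eq_map_conv)
  then have "as @ bs \<in> seqs (m - 1) I" "b \<in> I"
    using d len by (auto simp: seqs_def)
  then obtain x where x: "x \<in> I" "b \<in> hadd R (as @ x # bs)"
    using ideal unfolding hyperideal_def subhypergroup_def by metis
  have "fr b d \<in> hadd Q (map (\<lambda>a. fr a d) (as @ x # bs))"
    using x ys d len arity_m by (intro frac_in_hadd) (auto simp: I_carrier)
  then show "\<exists>X\<in>SI. B \<in> hadd Q (As @ X # Bs)"
    using x d ys by (intro bexI[of _ "fr x d"]) (auto simp: frac_ideal_def)
qed (use hadd_frac_ideal in blast)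

section \<open>Absorption, properness and primality of \<open>SI\<close>\<close>

lemma hyperideal_frac_ideal: "hyperideal m n Q SI"
  unfolding hyperideal_def
proof (intro conjI allI impI ballI)
  show "SI \<noteq> {}"
    using ideal e_in_S by (auto simp: hyperideal_def frac_ideal_def)
  fix As Bs X
  let ?F = "\<lambda>p. fr (fst p) (snd p)"
  assume AB: "As @ Bs \<in> seqs (n - 1) (carrier Q)" and X: "X \<in> SI"
  obtain ps where ps: "As = map ?F ps" "set ps \<subseteq> carrier R \<times> S"
    using AB by (auto simp: seqs_def elim: carrier_frac_list)
  obtain qs where qs: "Bs = map ?F qs" "set qs \<subseteq> carrier R \<times> S"
    using AB by (auto simp: seqs_def elim: carrier_frac_list)
  obtain a s where a: "a \<in> I" "s \<in> S" "X = fr a s"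
    using X by (auto simp: frac_ideal_def)
  let ?zs = "ps @ (a, s) # qs"
  have zs: "set ?zs \<subseteq> carrier R \<times> S" "length ?zs = n"
    using AB ps qs a arity_n by (auto simp: seqs_def I_carrier)
  \<comment> \<open>Absorption is available for \<open>g\<close> in any argument; the result is then
    transferred to the iterated product, the form in which \<open>gmul_frac\<close> yields the
    numerator.\<close>
  have "gmul R (map fst ps @ a # map fst qs) \<in> I"
    using ps qs AB a(1) by (intro gmul_I) (fastforce simp: seqs_def)+
  then have "bp (map fst ?zs) \<in> I"
    using gmul_eq_bprod[OF seqs_map_fst_snd(1)[OF zs]] by simp
  moreover have "bp (map snd ?zs) \<in> S"
    using zs by (intro bprod_S) auto
  moreover have "As @ X # Bs = map ?F ?zs"
    using ps qs a by simp
  ultimately show "gmul Q (As @ X # Bs) \<in> SI"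
    using gmul_frac[OF zs] by (auto simp: frac_ideal_def)
qed (use frac_ideal_subset_carrier subhypergroup_frac_ideal in auto)

text \<open>If \<open>1/1\<close> were in \<open>SI\<close>, the membership criterion would give
  some \<open>t \<in> S\<close> with \<open>t \<cdot> e = t\<close> in \<open>I\<close>.\<close>

lemma frac_ideal_proper:
  assumes "I \<inter> S = {}"
  shows "SI \<noteq> carrier Q"
proof
  assume "SI = carrier Q"
  then have "fr e e \<in> SI" using e_in_S e_carrier unfolding carrier_frac by blast
  then obtain t where "t \<in> S" "t \<in> I"
    using frac_in_frac_ideal_iff[of e e] e_in_S by (auto simp: S_carrier)
  with assms show False by blast
qed

text \<open>Primality in its elementwise form. The element \<open>s\<close> supplied by
  \<open>S\<close>-primality serves as the multiplier, possibly together with a factor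
  \<open>t\<close>, that shows one of the fractions to be in \<open>SI\<close>.\<close>

lemma frac_ideal_prime:
  assumes "S_prime_hyperideal m n R e S I" "Xs \<in> seqs n (carrier Q)" "gmul Q Xs \<in> SI"
  shows "\<exists>X\<in>set Xs. X \<in> SI"
proof -
  let ?F = "\<lambda>p. fr (fst p) (snd p)"
  obtain s where s: "s \<in> S"
    "\<And>xs. \<lbrakk>xs \<in> seqs n (carrier R); gmul R xs \<in> I\<rbrakk> \<Longrightarrow> \<exists>x\<in>set xs. s \<cdot> x \<in> I"
    using assms(1) by (auto simp: S_prime_hyperideal_def bmul_def)
  obtain ps where ps: "Xs = map ?F ps" "set ps \<subseteq> carrier R \<times> S"
    using assms(2) carrier_frac_list[of Xs] by (auto simp only: seqs_def mem_Collect_eq)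
  have len: "length ps = n" using assms(2) ps by (simp add: seqs_def)
  then obtain p qs where pq: "ps = p # qs" using arity_n by (cases ps) auto
  have qs: "set (map fst qs) \<subseteq> carrier R" "fst p \<in> carrier R" "snd p \<in> S"
    using ps(2) pq by auto
  have "fr (bp (map fst ps)) (bp (map snd ps)) \<in> SI"
    using assms(3) gmul_frac[OF ps(2) len] ps(1) by simp
  moreover have "bp (map fst ps) \<in> carrier R" "bp (map snd ps) \<in> S"
    using ps(2) by (fastforce intro!: bprod_closed bprod_S)+
  ultimately obtain t where t: "t \<in> S" "t \<cdot> bp (map fst ps) \<in> I"
    using frac_in_frac_ideal_iff by blast
  \<comment> \<open>Moving \<open>t\<close> into the first argument keeps the number of arguments at
    \<open>n\<close>, so that \<open>S\<close>-primality applies.\<close>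
  let ?xs = "(t \<cdot> fst p) # map fst qs"
  have xs: "?xs \<in> seqs n (carrier R)"
    using qs t len pq by (auto simp: seqs_def S_carrier)
  have "gmul R ?xs \<in> I"
    using t qs pq by (simp add: gmul_eq_bprod[OF xs] S_carrier mult_assoc)
  then obtain x where x: "x \<in> set ?xs" "s \<cdot> x \<in> I"
    using s(2)[OF xs] by blast
  \<comment> \<open>If the first argument is selected, the multiplier of \<open>fst p\<close> is
    \<open>s \<cdot> t\<close>; for any other argument it is \<open>s\<close> alone.\<close>
  then consider "s \<cdot> (t \<cdot> fst p) \<in> I" | q where "q \<in> set qs" "s \<cdot> fst q \<in> I"
    by auto
  then show ?thesis
  proof cases
    case 1
    then have "(s \<cdot> t) \<cdot> fst p \<in> I" using s t qs by (simp add: S_carrier mult_assoc)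
    then have "?F p \<in> SI"
      using qs s t frac_in_frac_ideal_iff mult_S by blast
    then show ?thesis using ps pq by simp
  next
    case 2
    then have "fst q \<in> carrier R" "snd q \<in> S" using ps(2) pq by auto
    with 2 s have "?F q \<in> SI" using frac_in_frac_ideal_iff by blast
    then show ?thesis using 2 ps pq by auto
  qed
qed

end

theorem theorem3p12:
  fixes m n :: nat and R :: "('a, 'c) hyperstructure_scheme" and e :: 'a and S I :: "'a set"
  assumes "krasner_hyperring m n R"
    and "scalar_identity n R e"
    and "multiplicative_subset n R S"
    and "e \<in> S"
    and "S_prime_hyperideal m n R e S I"
    and "I \<inter> S = {}"
  shows "prime_hyperideal m n (frac_hyperring n R e S) (frac_ideal n R e S I)"
proof -
  interpret krasner_hyperring m n R by fact
  interpret krasner_fractions_ideal m n R e S I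
    using assms by unfold_locales (auto simp: S_prime_hyperideal_def)
  have "\<exists>U\<in>set Us. U \<subseteq> SI"
    if len: "length Us = n" and ideals: "\<forall>U\<in>set Us. hyperideal m n Q U"
      and sub: "gmul Q ` listset Us \<subseteq> SI" for Us
  proof (rule ccontr)
    assume "\<not> (\<exists>U\<in>set Us. U \<subseteq> SI)"
    then have "\<forall>U\<in>set Us. \<exists>x. x \<in> U \<and> x \<notin> SI" by blast
    \<comment> \<open>Primality for hyperideals follows from the elementwise form: \<open>c\<close>
      picks from each hyperideal an element outside \<open>SI\<close>, yet the product of these
      elements lies in \<open>SI\<close>.\<close>
    then obtain c where c: "\<forall>U\<in>set Us. c U \<in> U \<and> c U \<notin> SI" by metis
    have "map c Us \<in> listset Us"
      using c by (auto simp: in_listset_iff list_all2_conv_all_nth)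
    then have "gmul Q (map c Us) \<in> SI" using sub by blast
    moreover have "map c Us \<in> seqs n (carrier Q)"
      using c ideals len by (fastforce simp: seqs_def hyperideal_def)
    ultimately obtain X where "X \<in> set (map c Us)" "X \<in> SI"
      using frac_ideal_prime assms(5) by blast
    with c show False by auto
  qed
  then show ?thesis
    using hyperideal_frac_ideal frac_ideal_proper assms(6) by (auto simp: prime_hyperideal_def)
qed

end
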